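(* Suppose that $f$ is a log-regular transcendental entire function which has the annular domain property for some $m>1$, and that $h$ is an entire function. Suppose also that, for this $m$, there exist $a\in(0,1)$ and $R_0>0$ such that $$a\,M(r,f)\ge M(r^m,h)\quad\text{for } r\ge R_0.$$ Let $g=f+h$. Then $A_R(g)$ is a spider's web, where $R>0$ is such that $M(r,g)>r$ for $r\ge R$.
   Context: For an entire function $f$ put $M(r,f)=\max_{|z|=r}|f(z)|$ for $r>0$. $f^n$ is the $n$th iterate of $f$, and $M^n(R,f)$ is the $n$th iterate of the map $r\mapsto M(r,f)$ applied to $R$. $\mathbb N=\{1,2,\ldots\}$ and $B(0,r)=\{z\in\mathbb C:|z|<r\}$. For a transcendental entire function $f$ and $R>0$ with $M(r,f)>r$ for all $r\ge R$, define $A_R(f)=\{z\in\mathbb C: |f^n(z)|\ge M^n(R,f)\text{ for } n\in\mathbb N\}$. A set $E\subset\mathbb C$ is a spider's web if $E$ is connected and there is a sequence $(G_n)_{n\in\mathbb N}$ of bounded simply connected domains with $G_n\subset G_{n+1}$ and $\partial G_n\subset E$ for all $n\in\mathbb N$, and $\bigcup_{n\in\mathbb N}G_n=\mathbb C$. An entire function $f$ has the annular domain property for $m>1$ if there exists $R_1>0$ such that, for all $r\ge R_1$, there is a simply connected domain $G=G(r)$ with $B(0,r)\subset G\subset B(0,r^m)$ and $|f(z)|\ge M(r,f)$ for all $z\in\partial G$. A transcendental entire function $f$ is log-regular (with constant $c>0$) if $\phi(t)=\log M(e^t,f)$ satisfies $\phi'(t)/\phi(t)\ge (1+c)/t$ for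 all large $t$; it is log-regular if this holds for some $c>0$. (Since $\phi$ is convex, $\phi'$ exists outside a countable set; at exceptional points $\phi'$ is read as the right derivative.) *)

theory Defs
  imports "HOL-Complex_Analysis.Complex_Analysis"
begin

(* M(r,f); for entire f the supremum over the compact circle is attained. *)
definition max_modulus :: "real \<Rightarrow> (complex \<Rightarrow> complex) \<Rightarrow> real" where
  "max_modulus r f = (SUP z\<in>sphere 0 r. norm (f z))"

definition entire :: "(complex \<Rightarrow> complex) \<Rightarrow> bool" where
  "entire f \<longleftrightarrow> f holomorphic_on UNIV"

definition transcendental_entire :: "(complex \<Rightarrow> complex) \<Rightarrow> bool" where
  "transcendental_entire f \<longleftrightarrow> entire f \<and> \<not> (\<exists>p. \<forall>z. f z = poly p z)"

definition simply_connected_domain :: "complex set \<Rightarrow> bool" where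
  "simply_connected_domain G \<longleftrightarrow> open G \<and> connected G \<and> G \<noteq> {} \<and> simply_connected G"

(* The set A_R(f). It is meant for transcendental entire f and R > 0
   with M(r,f) > r for all r \<ge> R. *)
definition fast_escaping_level :: "real \<Rightarrow> (complex \<Rightarrow> complex) \<Rightarrow> complex set" where
  "fast_escaping_level R f =
     {z. \<forall>n\<ge>1. norm ((f ^^ n) z) \<ge> ((\<lambda>r. max_modulus r f) ^^ n) R}"

definition spiders_web :: "complex set \<Rightarrow> bool" where
  "spiders_web E \<longleftrightarrow> connected E \<and>
     (\<exists>G :: nat \<Rightarrow> complex set.
        (\<forall>n. bounded (G n) \<and> simply_connected_domain (G n) \<and>
             G n \<subseteq> G (Suc n) \<and> frontier (G n) \<subseteq> E) \<and>
        (\<Union>n. G n) = UNIV)"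

definition annular_domain_property :: "real \<Rightarrow> (complex \<Rightarrow> complex) \<Rightarrow> bool" where
  "annular_domain_property m f \<longleftrightarrow>
     (\<exists>R1>0. \<forall>r\<ge>R1. \<exists>G. simply_connected_domain G \<and>
        ball 0 r \<subseteq> G \<and> G \<subseteq> ball 0 (r powr m) \<and>
        (\<forall>z\<in>frontier G. norm (f z) \<ge> max_modulus r f))"

(* The derivative of the convex function phi(t) = log M(e^t,f) is read as its right
   derivative, which agrees with phi' wherever phi is differentiable. *)
definition log_regular :: "(complex \<Rightarrow> complex) \<Rightarrow> bool" where
  "log_regular f \<longleftrightarrow>
     (\<exists>c>0. \<forall>\<^sub>F t in at_top. \<exists>d.
        ((\<lambda>s. ln (max_modulus (exp s) f)) has_real_derivative d) (at_right t) \<and>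
        d / ln (max_modulus (exp t) f) \<ge> (1 + c) / t)"

end

theory Submission
  imports Defs
begin

text \<open>Write \<open>\<rho> n\<close> for the \<open>n\<close>th iterate of \<open>R\<close> under \<open>r \<mapsto> M(r,g)\<close>. Log-regularity gives some \<open>k > 1\<close> with
  \<open>(1 - a) M(r\<^sup>k, f) \<ge> M(r, g)\<^sup>k\<^sup>m\<close> for large \<open>r\<close>. On the frontier of the annular domain \<open>G n\<close> for the
  radius \<open>(\<rho> n)\<^sup>k\<close> one has \<open>\<bar>g\<bar> \<ge> (1 - a) M((\<rho> n)\<^sup>k, f)\<close>, so \<open>g\<close> maps this frontier outside \<open>G (n + 1)\<close>.
  The complement of the level \<open>A\<^sub>R(g)\<close> is the increasing union of the open sets \<open>\<bar>g\<^sup>n\<bar> < \<rho> n\<close>; following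
  the frontiers forward shows that a component of it meeting the disc of radius \<open>\<rho> n\<close> lies in \<open>G n\<close>.
  Adding these components to the disc and filling holes yields the domains of the web. The part of the
  level in the closure of such a domain is a decreasing intersection of compact sets on which
  \<open>\<bar>g\<^sup>n\<bar> \<ge> \<rho> n\<close>; each is connected by the maximum principle, because it contains the connected
  boundary of the domain.\<close>

subsection \<open>The maximum modulus\<close>

lemma entire_continuous_on: "entire f \<Longrightarrow> continuous_on S f"
  unfolding entire_def using holomorphic_on_imp_continuous_on continuous_on_subset by blast

lemma max_modulus_attained:
  assumes "entire f" "r \<ge> 0"
  obtains z where "norm z = r" "max_modulus r f = norm (f z)"
proof -
  have "continuous_on (sphere 0 r) (\<lambda>z. norm (f z))"
    using entire_continuous_on[OF assms(1)] by (intro continuous_intros)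
  moreover have "sphere (0::complex) r \<noteq> {}"
    using assms(2) by simp
  ultimately obtain z where z: "z \<in> sphere 0 r" "\<And>w. w \<in> sphere 0 r \<Longrightarrow> norm (f w) \<le> norm (f z)"
    using continuous_attains_sup[OF compact_sphere] by blast
  then have "max_modulus r f = norm (f z)"
    unfolding max_modulus_def by (intro cSup_eq_maximum) auto
  with z that show ?thesis by simp
qed

lemma norm_le_max_modulus_sphere:
  assumes "entire f"
  shows "norm (f z) \<le> max_modulus (norm z) f"
proof -
  have "compact ((\<lambda>z. norm (f z)) ` sphere 0 (norm z))"
    using entire_continuous_on[OF assms]
    by (intro compact_continuous_image continuous_intros) auto
  then have "bdd_above ((\<lambda>z. norm (f z)) ` sphere 0 (norm z))"
    by (intro bounded_imp_bdd_above compact_imp_bounded)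
  then show ?thesis
    unfolding max_modulus_def by (intro cSUP_upper) auto
qed

lemma norm_le_max_modulus:
  assumes "entire f" "norm z \<le> r"
  shows "norm (f z) \<le> max_modulus r f"
proof (cases "r > 0")
  case True
  show ?thesis
  proof (rule maximum_modulus_frontier[where S = "cball 0 r" and f = f])
    show "f holomorphic_on interior (cball 0 r)"
      using assms(1) unfolding entire_def using holomorphic_on_subset by blast
    show "continuous_on (closure (cball 0 r)) f"
      using entire_continuous_on[OF assms(1)] .
    show "norm (f w) \<le> max_modulus r f" if "w \<in> frontier (cball 0 r)" for w
      using that norm_le_max_modulus_sphere[OF assms(1), of w] True by simp
  qed (use assms in auto)
next
  case False
  \<comment> \<open>A nonpositive \<open>r\<close> leaves only \<open>norm z = r = 0\<close>, where
    the bound on the sphere suffices.\<close>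
  then have "norm z = r"
    using assms(2) norm_ge_zero[of z] by linarith
  then show ?thesis
    using norm_le_max_modulus_sphere[OF assms(1), of z] by simp
qed

lemma max_modulus_nonneg:
  assumes "entire f" "r \<ge> 0"
  shows "max_modulus r f \<ge> 0"
  by (rule max_modulus_attained[OF assms]) simp

lemma max_modulus_mono:
  assumes "entire f" "0 \<le> r" "r \<le> s"
  shows "max_modulus r f \<le> max_modulus s f"
proof (rule max_modulus_attained[OF assms(1,2)])
  fix z assume "norm z = r" "max_modulus r f = norm (f z)"
  then show ?thesis using norm_le_max_modulus[OF assms(1), of z s] assms(3) by simp
qed

text \<open>An interior maximum would make \<open>f\<close> constant. Strictness is what carries the
  strict bounds defining the sublevel sets from one iterate to the next.\<close>

lemma norm_less_max_modulus:
  assumes "entire f" "\<not> f constant_on UNIV" "norm z < r"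
  shows "norm (f z) < max_modulus r f"
proof (rule ccontr)
  assume "\<not> norm (f z) < max_modulus r f"
  then have "norm (f w) \<le> norm (f z)" if "w \<in> ball 0 r" for w
    using norm_le_max_modulus[OF assms(1), of w r] that by simp
  then have "f constant_on UNIV"
    using assms by (intro maximum_modulus_principle[of f UNIV "ball 0 r" z]) (auto simp: entire_def)
  with assms(2) show False by blast
qed

lemma max_modulus_add_le:
  assumes "entire f" "entire h" "r \<ge> 0"
  shows "max_modulus r (\<lambda>z. f z + h z) \<le> max_modulus r f + max_modulus r h"
proof -
  have "entire (\<lambda>z. f z + h z)"
    using assms unfolding entire_def by (intro holomorphic_intros)
  then obtain z where z: "norm z = r" "max_modulus r (\<lambda>z. f z + h z) = norm (f z + h z)"
    using assms(3) by (rule max_modulus_attained)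
  have "norm (f z + h z) \<le> norm (f z) + norm (h z)"
    by (rule norm_triangle_ineq)
  also have "\<dots> \<le> max_modulus r f + max_modulus r h"
    using norm_le_max_modulus[OF assms(1)] norm_le_max_modulus[OF assms(2)] z(1)
    by (intro add_mono) auto
  finally show ?thesis using z by simp
qed

lemma max_modulus_gt_ev:
  assumes "entire f" "\<not> f constant_on UNIV"
  shows "\<forall>\<^sub>F r in at_top. max_modulus r f > B"
proof -
  have "\<not> bounded (range f)"
    using Liouville_theorem assms unfolding entire_def by blast
  then obtain z where "norm (f z) > B"
    unfolding bounded_iff by (auto simp: not_le)
  then have "max_modulus r f > B" if "r \<ge> norm z" for r
    using norm_le_max_modulus[OF assms(1) that] by linarith
  then show ?thesis
    unfolding eventually_at_top_linorder by blast
qed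

subsection \<open>Growth from log-regularity\<close>

text \<open>Only a right derivative is available and \<open>\<phi>\<close> is not known to be continuous, but at the
  supremum of the points where the bound holds, monotonicity replaces left continuity.\<close>

lemma power_growth_of_log_derivative:
  fixes \<phi> :: "real \<Rightarrow> real"
  assumes T: "T > 0" and q: "q < p"
    and mono: "\<And>s t. T \<le> s \<Longrightarrow> s \<le> t \<Longrightarrow> \<phi> s \<le> \<phi> t"
    and pos: "\<And>t. t \<ge> T \<Longrightarrow> \<phi> t > 0"
    and der: "\<And>t. t \<ge> T \<Longrightarrow> \<exists>d. (\<phi> has_real_derivative d) (at_right t) \<and> d / \<phi> t \<ge> p / t"
    and ab: "T \<le> t" "t \<le> u"
  shows "\<phi> t * (u / t) powr q \<le> \<phi> u"
proof -
  define S where "S = {x \<in> {t..u}. \<phi> t * (x / t) powr q \<le> \<phi> x}"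
  define s where "s = Sup S"
  have t0: "t > 0" using T ab by linarith
  have tS: "t \<in> S" using ab t0 by (simp add: S_def)
  have bdd: "bdd_above S" unfolding S_def by (intro bdd_aboveI[of _ u]) auto
  have ts: "t \<le> s" unfolding s_def by (rule cSup_upper[OF tS bdd])
  have su: "s \<le> u" unfolding s_def using tS by (intro cSup_least) (auto simp: S_def)
  have sS: "s \<in> S"
  proof -
    have "s \<in> closure S"
      unfolding s_def using closure_contains_Sup[OF _ bdd] tS by blast
    then obtain x where x: "\<And>n. x n \<in> S" "x \<longlonglongrightarrow> s"
      unfolding closure_sequential by blast
    have "(\<lambda>n. \<phi> t * (x n / t) powr q) \<longlonglongrightarrow> \<phi> t * (s / t) powr q"
      using x(2) t0 ts by (intro tendsto_intros) auto
    moreover have "\<phi> t * (x n / t) powr q \<le> \<phi> s" for n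
    proof -
      have "x n \<le> s" unfolding s_def by (rule cSup_upper[OF x(1) bdd])
      moreover have "T \<le> x n" "\<phi> t * (x n / t) powr q \<le> \<phi> (x n)"
        using x(1)[of n] ab by (auto simp: S_def)
      ultimately show ?thesis using mono[of "x n" s] by linarith
    qed
    ultimately have "\<phi> t * (s / t) powr q \<le> \<phi> s"
      using LIMSEQ_le_const2 by blast
    then show ?thesis using ts su by (simp add: S_def)
  qed
  have "s = u"
  proof (rule ccontr)
    assume "s \<noteq> u"
    then have su: "s < u" using su by simp
    have s0: "s > 0" using ts t0 by linarith
    have sT: "s \<ge> T" using ts ab by linarith
    obtain d where d: "(\<phi> has_real_derivative d) (at_right s)" "d / \<phi> s \<ge> p / s"
      using der[OF sT] by blast
    \<comment> \<open>The margin \<open>q < p\<close> makes the derivative at \<open>s\<close>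
      exceed that of the comparison power normalised to \<open>\<phi> s\<close> at \<open>s\<close>,
      so the bound persists a little beyond \<open>s\<close>.\<close>
    have dq: "d > \<phi> s * (q / s)"
    proof -
      have "q / s < d / \<phi> s"
        using q s0 d(2) by (smt (verit) divide_strict_right_mono)
      then show ?thesis using pos[OF sT] by (simp add: field_simps)
    qed
    have "((\<lambda>x. \<phi> x - \<phi> s * (x / s) powr q) has_real_derivative d - \<phi> s * (q / s)) (at_right s)"
      using s0 by (auto intro!: derivative_eq_intros d(1))
    from has_real_derivative_pos_inc_right[OF this] dq
    obtain e where e: "e > 0"
      "\<And>h. h > 0 \<Longrightarrow> h < e \<Longrightarrow> 0 < \<phi> (s + h) - \<phi> s * ((s + h) / s) powr q"
      using s0 by auto
    define h where "h = min (e / 2) (u - s)"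
    have h: "h > 0" "h < e" "s + h \<le> u" using e su by (auto simp: h_def)
    have "\<phi> t * ((s + h) / t) powr q = \<phi> t * (s / t) powr q * ((s + h) / s) powr q"
      using s0 t0 h by (simp add: powr_divide)
    also have "\<dots> \<le> \<phi> s * ((s + h) / s) powr q"
      using sS by (intro mult_right_mono) (auto simp: S_def)
    also have "\<dots> \<le> \<phi> (s + h)" using e(2)[OF h(1,2)] by simp
    finally have "s + h \<in> S" using h ts by (simp add: S_def)
    then have "s + h \<le> s" unfolding s_def by (intro cSup_upper bdd)
    with h show False by simp
  qed
  with sS show ?thesis by (simp add: S_def)
qed

text \<open>From \<open>ln r\<close> to \<open>k * ln r\<close> log-regularity multiplies
  \<open>\<phi>\<close> by at least a power of \<open>k\<close>; exponentiating turns this factor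
  into an exponent.\<close>

lemma log_regular_max_modulus_powr:
  assumes f: "entire f" "\<not> f constant_on UNIV" and lr: "log_regular f"
  obtains c where "c > 0"
    "\<And>k. k \<ge> 1 \<Longrightarrow>
      \<forall>\<^sub>F r in at_top. max_modulus r f powr (k powr (1 + c)) \<le> max_modulus (r powr k) f"
proof -
  define \<phi> where "\<phi> = (\<lambda>t. ln (max_modulus (exp t) f))"
  obtain c T1 where c: "c > 0" and der:
    "\<And>t. t \<ge> T1 \<Longrightarrow> \<exists>d. (\<phi> has_real_derivative d) (at_right t) \<and> d / \<phi> t \<ge> (1 + c) / t"
    using lr unfolding log_regular_def \<phi>_def eventually_at_top_linorder by blast
  obtain T2 where T2: "\<And>r. r \<ge> T2 \<Longrightarrow> max_modulus r f > 1"
    using max_modulus_gt_ev[OF f, of 1] unfolding eventually_at_top_linorder by blast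
  define T where "T = max 1 (max T1 T2)"
  have M1: "max_modulus (exp t) f > 1" if "t \<ge> T" for t
    using that exp_ge_add_one_self[of t] T_def by (intro T2) linarith
  have T: "T > 0" by (simp add: T_def)
  have mono: "\<phi> s \<le> \<phi> t" if "T \<le> s" "s \<le> t" for s t
    using M1[of s] M1[of t] max_modulus_mono[OF f(1), of "exp s" "exp t"] that
    by (simp add: \<phi>_def)
  have pos: "\<phi> t > 0" if "t \<ge> T" for t
    using M1[OF that] by (simp add: \<phi>_def)
  show ?thesis
  proof
    \<comment> \<open>Half of the constant, because the growth lemma demands an exponent strictly
      below \<open>1 + c\<close>.\<close>
    show "c / 2 > 0" using c by simp
    fix k :: real assume k: "k \<ge> 1"
    show "\<forall>\<^sub>F r in at_top. max_modulus r f powr (k powr (1 + c / 2)) \<le> max_modulus (r powr k) f"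
      unfolding eventually_at_top_linorder
    proof (intro exI allI impI)
      fix r assume "r \<ge> exp T"
      then have r: "r > 0" "ln r \<ge> T"
        using exp_gt_zero[of T] ln_ge_iff[of r T] by linarith+
      have le: "ln r \<le> k * ln r" using k r(2) T by (simp add: mult_le_cancel_right1)
      have "\<phi> (ln r) * ((k * ln r) / ln r) powr (1 + c / 2) \<le> \<phi> (k * ln r)"
        by (rule power_growth_of_log_derivative[OF T _ mono pos _ r(2) le, where p = "1 + c"])
          (use c der T_def in auto)
      moreover have "k * ln r / ln r = k"
        using r(2) T by (intro nonzero_mult_div_cancel_right) linarith
      moreover have "exp (k * ln r) = r powr k" using r by (simp add: powr_def)
      ultimately have *: "ln (max_modulus r f) * k powr (1 + c / 2) \<le> ln (max_modulus (r powr k) f)"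
        using r(1) by (simp add: \<phi>_def)
      have M: "max_modulus r f > 1" "max_modulus (r powr k) f > 1"
        using M1[OF r(2)] M1[of "k * ln r"] le r \<open>exp (k * ln r) = r powr k\<close> by auto
      have "max_modulus r f powr (k powr (1 + c / 2)) = exp (ln (max_modulus r f) * k powr (1 + c / 2))"
        using M(1) by (simp add: powr_def mult.commute)
      also have "\<dots> \<le> exp (ln (max_modulus (r powr k) f))"
        using * by simp
      finally show "max_modulus r f powr (k powr (1 + c / 2)) \<le> max_modulus (r powr k) f"
        using M(2) by simp
    qed
  qed
qed

subsection \<open>Plane topology\<close>

text \<open>\<open>- outside P\<close> is \<open>P\<close> with the bounded components of its
  complement filled in. As a component of the closed set \<open>- P\<close>,
  \<open>outside P\<close> is closed, has connected complement, and has its frontier inside that of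
  \<open>P\<close>. A bounded domain with connected complement is simply connected.\<close>

lemma fill_simply_connected:
  fixes P :: "complex set"
  assumes "open P" "connected P" "bounded P" "P \<noteq> {}"
  shows "simply_connected_domain (- outside P)"
    and "frontier (- outside P) \<subseteq> frontier P"
proof -
  have con: "connected (outside P)"
    using assms by (intro connected_outside) auto
  then have comp: "outside P \<in> components (- P)"
    using outside_bounded_nonempty assms(3) by (simp add: outside_in_components)
  then have "open (- outside P)"
    using closed_components[of "- P"] assms(1) by auto
  moreover have "connected (- outside P)"
    using component_complement_connected assms(2) comp by blast
  moreover have "bounded (- outside P)"
    using cobounded_outside assms(3) by blast
  moreover have "- outside P \<noteq> {}"
    using assms(4) outside_no_overlap[of P] by blast
  ultimately show "simply_connected_domain (- outside P)"
    unfolding simply_connected_domain_def using con by (simp add: simply_connected_iff_simple)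
  show "frontier (- outside P) \<subseteq> frontier P"
    using frontier_of_components_subset[OF comp] by (simp add: frontier_complement)
qed

text \<open>A clopen piece of the superlevel set that misses the boundary would contain a local
  maximum of the modulus.\<close>

lemma connected_closure_superlevel:
  fixes f :: "complex \<Rightarrow> complex"
  assumes f: "entire f" "\<not> f constant_on UNIV"
    and H: "open H" "bounded H" "connected (frontier H)"
    and frontier: "\<And>z. z \<in> frontier H \<Longrightarrow> c \<le> norm (f z)"
  shows "connected (closure H \<inter> {z. c \<le> norm (f z)})" (is "connected ?K")
proof -
  have cf: "continuous_on S (\<lambda>z. norm (f z))" for S
    using entire_continuous_on[OF f(1)] by (intro continuous_intros)
  have clK: "closed ?K"
    by (intro closed_Int closed_closure closed_Collect_le cf continuous_intros)
  have *: False if AB: "closed A" "closed B" "A \<noteq> {}" "A \<union> B = ?K" "A \<inter> B = {}"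
    and FB: "frontier H \<subseteq> B" for A B
  proof -
    have "closure H = H \<union> frontier H"
      using H(1) closure_Un_frontier by blast
    then have AH: "A \<subseteq> H" using AB FB by blast
    then have "compact A"
      using AB(1) H(2) bounded_subset compact_eq_bounded_closed by blast
    then obtain p where p: "p \<in> A" "\<And>z. z \<in> A \<Longrightarrow> norm (f z) \<le> norm (f p)"
      using continuous_attains_sup[OF _ AB(3) cf] by blast
    have "norm (f z) \<le> norm (f p)" if z: "z \<in> H - B" for z
    proof (cases "z \<in> A")
      case False
      then have "z \<notin> ?K" using AB z by blast
      then have "norm (f z) < c" using z closure_subset[of H] by auto
      moreover have "c \<le> norm (f p)" using p(1) AB(4) by blast
      ultimately show ?thesis by linarith
    qed (use p in blast)
    moreover have "open (H - B)" using H(1) AB(2) by blast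
    moreover have "p \<in> H - B" using p AH AB by blast
    ultimately have "f constant_on UNIV"
      using f(1) by (intro maximum_modulus_principle[of f UNIV "H - B" p]) (auto simp: entire_def)
    with f(2) show False by blast
  qed
  have FK: "frontier H \<subseteq> ?K"
    using frontier by (auto simp: frontier_def)
  show ?thesis
    unfolding connected_closed_set[OF clK]
  proof (intro notI, elim exE conjE)
    fix A B assume AB: "closed A" "closed B" "A \<union> B = ?K" "A \<inter> B = {}" "A \<noteq> {}" "B \<noteq> {}"
    \<comment> \<open>The connected frontier lies wholly in one piece; the other piece then plays
      the role of \<open>A\<close> in \<open>*\<close>.\<close>
    have "A \<inter> frontier H = {} \<or> B \<inter> frontier H = {}"
      by (rule connected_closedD[OF H(3)]) (use AB FK in auto)
    then consider "frontier H \<subseteq> A" | "frontier H \<subseteq> B"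
      using FK AB(3) by blast
    then show False
    proof cases
      case 1
      then show False using *[OF AB(2,1,6)] AB(3,4) by (metis Un_commute Int_commute)
    next
      case 2
      then show False using *[OF AB(1,2,5,3,4)] by blast
    qed
  qed
qed

lemma connected_UN_increasing:
  fixes K :: "nat \<Rightarrow> 'a::topological_space set"
  assumes "\<And>n. connected (K n)" "\<And>n. K n \<subseteq> K (Suc n)" "K 0 \<noteq> {}"
  shows "connected (\<Union>n. K n)"
proof -
  have "K 0 \<subseteq> K n" for n
    using lift_Suc_mono_le[of K 0 n] assms(2) by blast
  then have "K 0 \<subseteq> \<Inter>(range K)" by blast
  then show ?thesis
    using assms(1,3) by (intro connected_Union) auto
qed

subsection \<open>The levels of the fast escaping set\<close>

locale max_modulus_iteration =
  fixes g :: "complex \<Rightarrow> complex" and R :: real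
  assumes entire_g: "entire g"
    and R_pos: "R > 0"
    and max_modulus_gt: "\<And>r. r \<ge> R \<Longrightarrow> max_modulus r g > r"
begin

abbreviation \<rho> :: "nat \<Rightarrow> real" where
  "\<rho> n \<equiv> ((\<lambda>r. max_modulus r g) ^^ n) R"

abbreviation slow :: "nat \<Rightarrow> complex set" where
  "slow n \<equiv> {z. norm ((g ^^ n) z) < \<rho> n}"

abbreviation E :: "complex set" where
  "E \<equiv> fast_escaping_level R g"

lemma nonconstant: "\<not> g constant_on UNIV"
proof
  assume "g constant_on UNIV"
  then obtain w where w: "\<And>z. g z = w" unfolding constant_on_def by blast
  define r where "r = max R (norm w)"
  have "max_modulus r g = norm w"
    using max_modulus_attained[OF entire_g, of r] R_pos w by (force simp: r_def)
  with max_modulus_gt[of r] show False by (simp add: r_def)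
qed

lemma \<rho>_ge: "\<rho> n \<ge> R"
proof (induction n)
  case (Suc n)
  then show ?case using max_modulus_gt[of "\<rho> n"] by simp
qed simp

lemma \<rho>_mono: "m \<le> n \<Longrightarrow> \<rho> m \<le> \<rho> n"
proof (rule lift_Suc_mono_le[of \<rho>])
  show "\<rho> k \<le> \<rho> (Suc k)" for k
    using max_modulus_gt[OF \<rho>_ge[of k]] by simp
qed

text \<open>A bounded sequence would converge to some \<open>L \<ge> R\<close>, and continuity of
  \<open>g\<close> at a maximum point on the circle of radius \<open>L\<close> would give
  \<open>max_modulus L g \<le> L\<close>.\<close>

lemma \<rho>_at_top: "filterlim \<rho> at_top sequentially"
proof (rule ccontr)
  assume "\<not> ?thesis"
  then obtain B where B: "\<And>n. \<rho> n \<le> B"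
    using \<rho>_mono unfolding filterlim_at_top eventually_sequentially
    by (meson linorder_le_cases order_trans)
  then obtain L where L: "\<rho> \<longlonglongrightarrow> L" "\<And>n. \<rho> n \<le> L"
    using incseq_convergent[of \<rho> B] \<rho>_mono by (auto simp: incseq_def)
  have L0: "L > 0" "L \<ge> R"
    using L(2)[of 0] R_pos by auto
  obtain z where z: "norm z = L" "max_modulus L g = norm (g z)"
    using max_modulus_attained[OF entire_g, of L] L0 by auto
  \<comment> \<open>The maximum point \<open>z\<close> is moved radially to the circle of radius
    \<open>\<rho> n\<close>, where \<open>g\<close> has modulus at most
    \<open>\<rho> (Suc n) \<le> L\<close>.\<close>
  define w where "w n = of_real (\<rho> n / L) * z" for n
  have "(\<lambda>n. of_real (\<rho> n / L) * z) \<longlonglongrightarrow> of_real (L / L) * z"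
    using L L0 by (intro tendsto_intros) auto
  then have wz: "w \<longlonglongrightarrow> z" using L0 by (simp add: w_def[abs_def])
  have "isCont g z"
    using entire_continuous_on[OF entire_g, of UNIV] continuous_on_eq_continuous_at by blast
  then have "(\<lambda>n. g (w n)) \<longlonglongrightarrow> g z"
    using wz isCont_tendsto_compose by blast
  then have "(\<lambda>n. norm (g (w n))) \<longlonglongrightarrow> norm (g z)"
    by (rule tendsto_norm)
  moreover have "norm (g (w n)) \<le> L" for n
  proof -
    have "\<rho> n > 0" using \<rho>_ge[of n] R_pos by linarith
    then have "norm (w n) = \<rho> n"
      using z L0 by (simp add: w_def norm_mult norm_divide)
    then have "norm (g (w n)) \<le> \<rho> (Suc n)"
      using norm_le_max_modulus[OF entire_g, of "w n" "\<rho> n"] by simp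
    then show ?thesis using L(2)[of "Suc n"] by linarith
  qed
  ultimately have "norm (g z) \<le> L"
    using LIMSEQ_le_const2 by blast
  with z max_modulus_gt[OF L0(2)] show False by simp
qed

section \<open>Iterates of \<open>g\<close> and their sublevel sets\<close>

lemma holomorphic_iterate: "(g ^^ n) holomorphic_on UNIV"
proof (induction n)
  case (Suc n)
  then show ?case
    using entire_g holomorphic_on_compose[of "g ^^ n" UNIV g] holomorphic_on_subset
    unfolding entire_def by (auto simp: comp_def)
qed (simp add: id_def)

lemma continuous_iterate: "continuous_on S (g ^^ n)"
  using holomorphic_iterate entire_continuous_on unfolding entire_def by blast

text \<open>The open mapping theorem is applied once per iterate. Open ranges exclude constant
  iterates, which makes the maximum principle available for each of them.\<close>

lemma open_range_iterate: "open (range (g ^^ n))"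
proof (induction n)
  case (Suc n)
  have "open (g ` range (g ^^ n))"
    using entire_g nonconstant Suc unfolding entire_def
    by (intro open_mapping_thm[of g UNIV]) auto
  then show ?case by (simp add: image_comp comp_def)
qed simp

lemma iterate_nonconstant: "\<not> (g ^^ n) constant_on UNIV"
proof
  assume "(g ^^ n) constant_on UNIV"
  then obtain w where "range (g ^^ n) = {w}" unfolding constant_on_def by auto
  with open_range_iterate[of n] show False by (simp add: not_open_singleton)
qed

text \<open>Monotonicity lets a compact subset of \<open>- E\<close> lie in a single
  \<open>slow n\<close>, and makes the compact sets left after removing \<open>slow k\<close>
  decrease with \<open>k\<close>.\<close>

lemma slow_Suc: "slow n \<subseteq> slow (Suc n)"
  using norm_less_max_modulus[OF entire_g nonconstant] by auto

lemma slow_mono: "m \<le> n \<Longrightarrow> slow m \<subseteq> slow n"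
  using lift_Suc_mono_le[of slow m n] slow_Suc by blast

lemma open_slow: "open (slow n)"
  by (intro open_Collect_less continuous_intros continuous_iterate)

lemma compl_fast_escaping_level: "- E = (\<Union>n. slow n)"
proof -
  have "z \<notin> E \<longleftrightarrow> (\<exists>n\<ge>1. z \<in> slow n)" for z
    unfolding fast_escaping_level_def mem_Collect_eq not_all not_imp not_le by blast
  \<comment> \<open>The level imposes its condition only from \<open>n = 1\<close> on;
    \<open>slow 0\<close> adds nothing, being contained in \<open>slow 1\<close>.\<close>
  moreover have "(\<exists>n\<ge>1. z \<in> slow n) \<longleftrightarrow> (\<exists>n. z \<in> slow n)" for z
  proof
    assume "\<exists>n. z \<in> slow n"
    then obtain n where "z \<in> slow n" by blast
    then have "z \<in> slow (Suc n)" using slow_Suc by blast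
    then show "\<exists>n\<ge>1. z \<in> slow n" by (intro exI[of _ "Suc n"]) simp
  qed blast
  ultimately show ?thesis by blast
qed

lemma open_compl_level: "open (- E)"
  unfolding compl_fast_escaping_level using open_slow by blast

lemma norm_iterate_less:
  assumes "norm z < \<rho> N"
  shows "norm ((g ^^ k) z) < \<rho> (N + k)"
proof (induction k)
  case (Suc k)
  then show ?case using norm_less_max_modulus[OF entire_g nonconstant] by simp
qed (use assms in simp)

section \<open>Discs enlarged by components of the complement of the level\<close>

definition core :: "nat \<Rightarrow> complex set" where
  "core N = ball 0 (\<rho> N) \<union> \<Union>{X \<in> components (- E). X \<inter> ball 0 (\<rho> N) \<noteq> {}}"

lemma ball_subset_core: "ball 0 (\<rho> N) \<subseteq> core N"
  unfolding core_def by blast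

lemma core_mono: "M \<le> N \<Longrightarrow> core M \<subseteq> core N"
  using subset_ball[OF \<rho>_mono, of M N 0] unfolding core_def by blast

lemma open_core: "open (core N)"
  unfolding core_def using open_components[OF open_compl_level] by (intro open_Un open_ball open_Union) blast

lemma connected_core: "connected (core N)"
proof -
  \<comment> \<open>Each component is first joined to the disc, so that all members of the union are
    connected and share the point \<open>0\<close>.\<close>
  have "connected (\<Union>(insert (ball 0 (\<rho> N))
      ((\<lambda>X. ball 0 (\<rho> N) \<union> X) ` {X \<in> components (- E). X \<inter> ball 0 (\<rho> N) \<noteq> {}})))"
  proof (rule connected_Union)
    have "0 \<in> ball (0::complex) (\<rho> N)" using \<rho>_ge[of N] R_pos by simp
    then show "\<Inter>(insert (ball 0 (\<rho> N))
      ((\<lambda>X. ball 0 (\<rho> N) \<union> X) ` {X \<in> components (- E). X \<inter> ball 0 (\<rho> N) \<noteq> {}})) \<noteq> {}"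
      by blast
  next
    fix s assume "s \<in> insert (ball 0 (\<rho> N))
      ((\<lambda>X. ball 0 (\<rho> N) \<union> X) ` {X \<in> components (- E). X \<inter> ball 0 (\<rho> N) \<noteq> {}})"
    then show "connected s"
      using in_components_connected[of _ "- E"]
      by (auto intro!: connected_Un connected_ball simp: Int_commute)
  qed
  moreover have "\<Union>(insert (ball 0 (\<rho> N))
      ((\<lambda>X. ball 0 (\<rho> N) \<union> X) ` {X \<in> components (- E). X \<inter> ball 0 (\<rho> N) \<noteq> {}})) = core N"
    unfolding core_def by blast
  ultimately show ?thesis by simp
qed

text \<open>A frontier point outside \<open>E\<close> would lie in an open component that meets
  \<open>core N\<close>. Distinct components being disjoint, this component meets the disc and was
  added as a whole, so the point would be interior.\<close>

lemma frontier_core: "frontier (core N) \<subseteq> E"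
proof
  fix z assume z: "z \<in> frontier (core N)"
  show "z \<in> E"
  proof (rule ccontr)
    assume "z \<notin> E"
    then obtain X where X: "X \<in> components (- E)" "z \<in> X"
      using Union_components[of "- E"] by blast
    have oX: "open X" using open_components[OF open_compl_level] X by blast
    have "z \<in> closure (core N)" using z by (simp add: frontier_def)
    then have "X \<inter> core N \<noteq> {}"
      using oX X(2) open_Int_closure_eq_empty by blast
    then have "X \<inter> ball 0 (\<rho> N) \<noteq> {}"
      using components_eq[OF X(1)] unfolding core_def by blast
    then have "X \<subseteq> core N" using X(1) unfolding core_def by blast
    then have "z \<in> core N" using X by blast
    with z show False using open_core by (simp add: frontier_def interior_open)
  qed
qed

text \<open>Pushing a connected set forward that joins \<open>ball 0 (\<rho> N)\<close> to the complement of \<open>G N\<close>,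
  every iterate keeps meeting the complement of the corresponding barrier domain.\<close>

lemma connected_slow_subset_barrier:
  assumes ball: "\<And>n. n \<ge> N \<Longrightarrow> ball 0 (\<rho> n) \<subseteq> G n"
    and frontier: "\<And>n z. n \<ge> N \<Longrightarrow> z \<in> frontier (G n) \<Longrightarrow> g z \<notin> G (Suc n)"
    and C: "connected C" "C \<subseteq> slow j" "C \<inter> ball 0 (\<rho> N) \<noteq> {}"
  shows "C \<subseteq> G N"
proof (rule ccontr)
  assume nC: "\<not> C \<subseteq> G N"
  obtain y where y: "y \<in> C" "norm y < \<rho> N" using C(3) by auto
  have "\<exists>z\<in>C. (g ^^ k) z \<notin> G (N + k)" for k
  proof (induction k)
    case (Suc k)
    have "connected ((g ^^ k) ` C)"
      by (intro connected_continuous_image continuous_iterate C)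
    moreover have "(g ^^ k) y \<in> G (N + k)"
      using norm_iterate_less[OF y(2), of k] ball[of "N + k"] by auto
    ultimately have "(g ^^ k) ` C \<inter> frontier (G (N + k)) \<noteq> {}"
      using y(1) Suc by (intro connected_Int_frontier) blast+
    then obtain z where "z \<in> C" "(g ^^ k) z \<in> frontier (G (N + k))" by blast
    then show ?case using frontier[of "N + k"] by auto
  qed (use nC in auto)
  \<comment> \<open>The iterate chosen is the \<open>j\<close> of \<open>slow j\<close>: escaping
    \<open>G (N + j)\<close> forces modulus at least
    \<open>\<rho> (N + j) \<ge> \<rho> j\<close>.\<close>
  then obtain z where z: "z \<in> C" "(g ^^ j) z \<notin> G (N + j)" by blast
  then have "\<rho> (N + j) \<le> norm ((g ^^ j) z)"
    using ball[of "N + j"] by (force simp: not_le)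
  moreover have "norm ((g ^^ j) z) < \<rho> j" using C(2) z(1) by blast
  ultimately show False using \<rho>_mono[of j "N + j"] by linarith
qed

text \<open>A component is only known to be covered by the union of the \<open>slow n\<close>. A
  path in it is compact, hence lies in one of them, and the previous lemma applies to the
  path.\<close>

lemma component_subset_barrier:
  assumes ball: "\<And>n. n \<ge> N \<Longrightarrow> ball 0 (\<rho> n) \<subseteq> G n"
    and frontier: "\<And>n z. n \<ge> N \<Longrightarrow> z \<in> frontier (G n) \<Longrightarrow> g z \<notin> G (Suc n)"
    and X: "X \<in> components (- E)" "X \<inter> ball 0 (\<rho> N) \<noteq> {}"
  shows "X \<subseteq> G N"
proof
  fix y assume y: "y \<in> X"
  obtain x where x: "x \<in> X" "x \<in> ball 0 (\<rho> N)" using X(2) by blast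
  have "path_connected X"
    using X(1) open_components[OF open_compl_level] in_components_connected
      connected_open_path_connected by blast
  then obtain p where p: "path p" "path_image p \<subseteq> X" "pathstart p = x" "pathfinish p = y"
    using x(1) y unfolding path_connected_def by blast
  have "path_image p \<subseteq> (\<Union>n\<in>UNIV. slow n)"
    using p(2) in_components_subset[OF X(1)] unfolding compl_fast_escaping_level by simp
  then obtain F where F: "finite F" "path_image p \<subseteq> (\<Union>n\<in>F. slow n)"
    by (rule compactE_image[OF compact_path_image[OF p(1)] open_slow])
  have "slow n \<subseteq> slow (Max F)" if "n \<in> F" for n
    using slow_mono[of n "Max F"] that F(1) by simp
  then have "path_image p \<subseteq> slow (Max F)" using F(2) by blast
  moreover have "path_image p \<inter> ball 0 (\<rho> N) \<noteq> {}"
    using x(2) pathstart_in_path_image[of p] p(3) by blast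
  ultimately have "path_image p \<subseteq> G N"
    using connected_path_image[OF p(1)]
    by (intro connected_slow_subset_barrier[OF ball frontier, where j = "Max F"]) auto
  then show "y \<in> G N" using pathfinish_in_path_image[of p] p(4) by blast
qed

text \<open>The barriers \<open>G n\<close> serve to bound the sets \<open>core n\<close>. The
  domains of the web are the filled cores, since their frontiers lie in \<open>E\<close>.\<close>

theorem spiders_web_of_barriers:
  assumes bounded: "\<And>n. n \<ge> N \<Longrightarrow> bounded (G n)"
    and ball: "\<And>n. n \<ge> N \<Longrightarrow> ball 0 (\<rho> n) \<subseteq> G n"
    and frontier: "\<And>n z. n \<ge> N \<Longrightarrow> z \<in> frontier (G n) \<Longrightarrow> g z \<notin> G (Suc n)"
  shows "spiders_web E"
proof -
  \<comment> \<open>The shift by \<open>N\<close> starts the sequence at the first index with a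
    barrier.\<close>
  define H where "H n = - outside (core (N + n))" for n
  have core_G: "core (N + n) \<subseteq> G (N + n)" for n
    using component_subset_barrier[of "N + n" G] ball[of "N + n"] ball frontier
    unfolding core_def by (auto simp: subset_iff)
  have bcore: "bounded (core (N + n))" for n
    by (rule bounded_subset[OF bounded core_G]) simp
  have zero: "0 \<in> core (N + n)" for n
    using ball_subset_core[of "N + n"] \<rho>_ge[of "N + n"] R_pos by auto
  have core_ne: "core (N + n) \<noteq> {}" for n
    using zero by blast
  note fill = fill_simply_connected[OF open_core connected_core bcore core_ne]
  have sc: "simply_connected_domain (H n)" for n
    unfolding H_def by (rule fill(1))
  have frH: "frontier (H n) \<subseteq> E" for n
    unfolding H_def using fill(2) frontier_core by blast
  have bH: "bounded (H n)" for n
    unfolding H_def using cobounded_outside bcore by blast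
  have coreH: "core (N + n) \<subseteq> H n" for n
    unfolding H_def using outside_no_overlap[of "core (N + n)"] by blast
  have HSuc: "H n \<subseteq> H (Suc n)" for n
    unfolding H_def using outside_mono[OF core_mono[of "N + n" "N + Suc n"]] by auto
  have UH: "(\<Union>n. H n) = UNIV"
  proof -
    have "z \<in> (\<Union>n. H n)" for z
    proof -
      have "\<forall>\<^sub>F n in sequentially. norm z < \<rho> n"
        using \<rho>_at_top by (simp add: filterlim_at_top_dense)
      then obtain n where "n \<ge> N" "norm z < \<rho> n"
        unfolding eventually_sequentially by (meson linorder_le_cases order_refl)
      then have "z \<in> core (N + (n - N))"
        using ball_subset_core[of n] by auto
      then show ?thesis using coreH by blast
    qed
    then show ?thesis by blast
  qed
  have level: "E \<inter> closure (H n) = (\<Inter>k. closure (H n) - slow k)" for n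
    using compl_fast_escaping_level by blast
  have con: "connected (E \<inter> closure (H n))" for n
    unfolding level
  proof (rule connected_nest)
    fix k
    show "compact (closure (H n) - slow k)"
      using bH[of n] open_slow compact_closure by (intro compact_diff) blast+
    \<comment> \<open>A bounded simply connected domain has connected frontier, so the superlevel
      lemma applies to \<open>g ^^ k\<close> at height \<open>\<rho> k\<close>.\<close>
    have "connected (frontier (H n))"
      using sc[of n] bH[of n] connected_frontier_simple simply_connected_iff_simple
      unfolding simply_connected_domain_def by blast
    then have "connected (closure (H n) \<inter> {z. \<rho> k \<le> norm ((g ^^ k) z)})"
    proof (intro connected_closure_superlevel iterate_nonconstant)
      show "\<rho> k \<le> norm ((g ^^ k) z)" if "z \<in> frontier (H n)" for z
      proof -
        have "z \<notin> slow k" using that frH compl_fast_escaping_level by blast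
        then show ?thesis by simp
      qed
    qed (use sc bH holomorphic_iterate in \<open>auto simp: simply_connected_domain_def entire_def\<close>)
    moreover have "closure (H n) \<inter> {z. \<rho> k \<le> norm ((g ^^ k) z)} = closure (H n) - slow k"
      by auto
    ultimately show "connected (closure (H n) - slow k)" by simp
  next
    fix k l :: nat assume "k \<le> l"
    then show "closure (H n) - slow l \<subseteq> closure (H n) - slow k"
      using slow_mono by blast
  qed
  have "connected (\<Union>n. E \<inter> closure (H n))"
  proof (rule connected_UN_increasing[OF con])
    show "E \<inter> closure (H n) \<subseteq> E \<inter> closure (H (Suc n))" for n
      using closure_mono[OF HSuc] by blast
    \<comment> \<open>This frontier supplies points of \<open>E\<close> common to the whole
      increasing union.\<close>
    have "frontier (H 0) \<noteq> {}"
      using bH[of 0] sc[of 0] frontier_eq_empty[of "H 0"] not_bounded_UNIV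
      unfolding simply_connected_domain_def by metis
    then show "E \<inter> closure (H 0) \<noteq> {}"
      using frH[of 0] unfolding frontier_def by blast
  qed
  moreover have "(\<Union>n. E \<inter> closure (H n)) = E"
    using UH closure_subset by blast
  ultimately have "connected E" by simp
  then show ?thesis
    unfolding spiders_web_def using bH sc HSuc frH UH by blast
qed

end

subsection \<open>Perturbation\<close>

text \<open>With \<open>x = max_modulus r f\<close>, the perturbed maximum modulus is at most
  \<open>2 * x\<close>, while log-regularity bounds \<open>max_modulus (r powr k) f\<close> below by
  \<open>x\<close> to the power \<open>2 * (k * m)\<close>. One factor \<open>x powr (k * m)\<close>
  is the desired growth; the other absorbs the constants.\<close>

lemma max_modulus_perturbed_growth:
  assumes f: "entire f" "\<not> f constant_on UNIV" "log_regular f" and h: "entire h"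
    and m: "m > 1" and a: "0 < a" "a < 1"
    and bound: "\<And>r. r \<ge> R\<^sub>0 \<Longrightarrow> a * max_modulus r f \<ge> max_modulus (r powr m) h"
  obtains k where "k > 1"
    "\<forall>\<^sub>F r in at_top. max_modulus r (\<lambda>z. f z + h z) powr (k * m) \<le> (1 - a) * max_modulus (r powr k) f"
proof -
  obtain c where c: "c > 0" and powr_le: "\<And>k. k \<ge> 1 \<Longrightarrow>
      \<forall>\<^sub>F r in at_top. max_modulus r f powr (k powr (1 + c)) \<le> max_modulus (r powr k) f"
    using log_regular_max_modulus_powr[OF f] by blast
  \<comment> \<open>Chosen so that \<open>k powr c = 2 * m\<close>, which makes the exponent
    \<open>k powr (1 + c)\<close> twice the required \<open>k * m\<close>.\<close>
  define k where "k = (2 * m) powr (1 / c)"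
  have k: "k > 1" unfolding k_def using m c by (intro gr_one_powr) auto
  have kc: "k powr (1 + c) = 2 * (k * m)"
    using k m c by (simp add: powr_add) (simp add: k_def powr_powr)
  have "1 * 1 \<le> k * m" using k m by (intro mult_mono) auto
  then have km: "k * m \<ge> 1" by simp
  have "\<forall>\<^sub>F r in at_top. max_modulus r (\<lambda>z. f z + h z) powr (k * m) \<le> (1 - a) * max_modulus (r powr k) f"
    using powr_le[OF less_imp_le[OF k]] max_modulus_gt_ev[OF f(1,2), of "2 / (1 - a)"]
      eventually_ge_at_top[of 1] eventually_ge_at_top[of R\<^sub>0]
  proof eventually_elim
    case (elim r)
    define x where "x = max_modulus r f"
    have x: "x > 0" using elim(2) a x_def
      by (smt (verit) divide_nonneg_nonneg)
    \<comment> \<open>The hypothesis controls \<open>h\<close> at radius \<open>r powr m\<close>,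
      which exceeds \<open>r\<close> or equals it once \<open>r \<ge> 1\<close>.\<close>
    have "r powr 1 \<le> r powr m" using elim(3) m by (intro powr_mono) auto
    then have "max_modulus r h \<le> max_modulus (r powr m) h"
      using elim(3) by (intro max_modulus_mono h) auto
    also have "\<dots> \<le> a * x" using bound[OF elim(4)] by (simp add: x_def)
    also have "\<dots> \<le> x" using a x by simp
    finally have "max_modulus r (\<lambda>z. f z + h z) \<le> 2 * x"
      using max_modulus_add_le[OF f(1) h, of r] elim(3) by (simp add: x_def)
    moreover have "max_modulus r (\<lambda>z. f z + h z) \<ge> 0"
      using f(1) h elim(3) by (intro max_modulus_nonneg) (auto simp: entire_def intro!: holomorphic_intros)
    ultimately have "max_modulus r (\<lambda>z. f z + h z) powr (k * m) \<le> (2 * x) powr (k * m)"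
      using km by (intro powr_mono2) auto
    also have "\<dots> = 2 powr (k * m) * x powr (k * m)"
      using x by (simp add: powr_mult)
    \<comment> \<open>Here \<open>x > 2 / (1 - a)\<close> is used in the form
      \<open>2 \<le> (1 - a) * x\<close>.\<close>
    also have "\<dots> \<le> ((1 - a) * x) powr (k * m) * x powr (k * m)"
      using elim(2) a km by (intro mult_right_mono powr_mono2) (auto simp: x_def field_simps)
    also have "\<dots> = (1 - a) powr (k * m) * x powr (k powr (1 + c))"
      unfolding kc unfolding mult_2 powr_add using x a by (simp add: powr_mult)
    also have "\<dots> \<le> (1 - a) powr 1 * x powr (k powr (1 + c))"
      using a km by (intro mult_right_mono powr_mono') auto
    also have "\<dots> = (1 - a) * x powr (k powr (1 + c))"
      using a by simp
    also have "\<dots> \<le> (1 - a) * max_modulus (r powr k) f"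
      using elim(1) a by (intro mult_left_mono) (auto simp: x_def)
    finally show ?case .
  qed
  with k that show ?thesis by blast
qed

theorem theorem4p2:
  fixes f h g :: "complex \<Rightarrow> complex" and m a R\<^sub>0 R :: real
  assumes "transcendental_entire f"
    and "log_regular f"
    and "m > 1"
    and "annular_domain_property m f"
    and "entire h"
    and "0 < a" and "a < 1"
    and "R\<^sub>0 > 0"
    and "\<And>r. r \<ge> R\<^sub>0 \<Longrightarrow> a * max_modulus r f \<ge> max_modulus (r powr m) h"
    and "g = (\<lambda>z. f z + h z)"
    and "R > 0"
    and "\<And>r. r \<ge> R \<Longrightarrow> max_modulus r g > r"
  shows "spiders_web (fast_escaping_level R g)"
proof -
  have f: "entire f" using assms(1) by (simp add: transcendental_entire_def)
  have nf: "\<not> f constant_on UNIV"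
  proof
    assume "f constant_on UNIV"
    then obtain w where "\<And>z. f z = w" unfolding constant_on_def by blast
    then have "\<forall>z. f z = poly [:w:] z" by simp
    with assms(1) show False unfolding transcendental_entire_def by blast
  qed
  have "entire g"
    using f assms(5) unfolding assms(10) entire_def by (intro holomorphic_intros)
  then interpret max_modulus_iteration g R
    using assms(11,12) by unfold_locales auto
  obtain R1 D where D: "\<And>r. r \<ge> R1 \<Longrightarrow> ball 0 r \<subseteq> D r \<and> D r \<subseteq> ball 0 (r powr m) \<and>
      (\<forall>z\<in>frontier (D r). max_modulus r f \<le> norm (f z))"
    using assms(4) unfolding annular_domain_property_def by metis
  obtain k where k: "k > 1" and
    ev: "\<forall>\<^sub>F r in at_top. max_modulus r g powr (k * m) \<le> (1 - a) * max_modulus (r powr k) f"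
    unfolding assms(10)
    by (rule max_modulus_perturbed_growth[OF f nf assms(2,5,3,6,7,9)])
  have "\<forall>\<^sub>F r in at_top. max_modulus r g powr (k * m) \<le> (1 - a) * max_modulus (r powr k) f
      \<and> r \<ge> 1 \<and> r \<ge> R\<^sub>0 \<and> r \<ge> R1"
    by (intro eventually_conj ev eventually_ge_at_top)
  \<comment> \<open>The conditions on large radii are transported to large indices, because
    \<open>\<rho>\<close> tends to infinity.\<close>
  then have "\<forall>\<^sub>F n in sequentially. max_modulus (\<rho> n) g powr (k * m) \<le> (1 - a) * max_modulus (\<rho> n powr k) f
      \<and> \<rho> n \<ge> 1 \<and> \<rho> n \<ge> R\<^sub>0 \<and> \<rho> n \<ge> R1"
    by (rule eventually_compose_filterlim[OF _ \<rho>_at_top])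
  then obtain N where N: "\<And>n. n \<ge> N \<Longrightarrow>
      max_modulus (\<rho> n) g powr (k * m) \<le> (1 - a) * max_modulus (\<rho> n powr k) f"
    and ge: "\<And>n. n \<ge> N \<Longrightarrow> \<rho> n \<ge> 1 \<and> \<rho> n \<ge> R\<^sub>0 \<and> \<rho> n \<ge> R1"
    unfolding eventually_sequentially by blast
  have powr_ge: "\<rho> n \<le> \<rho> n powr k" if "n \<ge> N" for n
    using powr_mono[of 1 k "\<rho> n"] k ge[OF that] by simp
  have Dn: "ball 0 (\<rho> n powr k) \<subseteq> D (\<rho> n powr k)"
    "D (\<rho> n powr k) \<subseteq> ball 0 (\<rho> n powr (k * m))"
    "\<And>z. z \<in> frontier (D (\<rho> n powr k)) \<Longrightarrow> max_modulus (\<rho> n powr k) f \<le> norm (f z)"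
    if "n \<ge> N" for n
    using D[of "\<rho> n powr k"] powr_ge[OF that] ge[OF that] by (auto simp: powr_powr)
  show ?thesis
  proof (rule spiders_web_of_barriers[where N = N and G = "\<lambda>n. D (\<rho> n powr k)"])
    fix n assume n: "n \<ge> N"
    show "bounded (D (\<rho> n powr k))"
      using Dn(2)[OF n] bounded_ball bounded_subset by blast
    show "ball 0 (\<rho> n) \<subseteq> D (\<rho> n powr k)"
      using Dn(1)[OF n] powr_ge[OF n] subset_ball by blast
    fix z assume z: "z \<in> frontier (D (\<rho> n powr k))"
    have "closure (D (\<rho> n powr k)) \<subseteq> cball 0 (\<rho> n powr (k * m))"
      using Dn(2)[OF n] by (intro closure_minimal) auto
    \<comment> \<open>The outer radius of the annular domain is exactly the radius at which the
      hypothesis for \<open>r = \<rho> n powr k\<close> bounds \<open>h\<close>.\<close>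
    then have "norm z \<le> (\<rho> n powr k) powr m"
      using z by (auto simp: frontier_def powr_powr)
    then have "norm (h z) \<le> max_modulus ((\<rho> n powr k) powr m) h"
      by (rule norm_le_max_modulus[OF assms(5)])
    also have "\<dots> \<le> a * max_modulus (\<rho> n powr k) f"
      using ge[OF n] powr_ge[OF n] by (intro assms(9)) linarith
    finally have "(1 - a) * max_modulus (\<rho> n powr k) f \<le> norm (f z) - norm (h z)"
      using Dn(3)[OF n z] by (simp add: algebra_simps)
    also have "\<dots> \<le> norm (g z)"
      using norm_diff_ineq[of "f z" "h z"] by (simp add: assms(10))
    \<comment> \<open>The left side is the radius of the open disc containing the next barrier
      domain, so \<open>g z\<close> lies outside that domain.\<close>
    finally have "\<rho> (Suc n) powr (k * m) \<le> norm (g z)"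
      using N[OF n] by simp
    then show "g z \<notin> D (\<rho> (Suc n) powr k)"
      using Dn(2)[of "Suc n"] n by (force simp: subset_iff)
  qed
qed

end
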